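(* The node component $\nabla_{\rm node}(\emptyset)$ in the singular locus of the $2\times2\times2\times2$-hyperdeterminant coincides with the variety $\mathcal{V}_4\subset\mathbb{P}^{15}$ parametrized by the principal minors of a generic $4\times4$-matrix. In symbols, $\mathcal{V}_4=\nabla_{\rm node}(\emptyset)$.
   Context: Definition of $\mathcal{V}_4$. For complex $4\times4$-matrices $A,B$ and $I\subseteq[4]=\{1,2,3,4\}$, let $\det(A_IB_{[4]\setminus I})$ be the determinant of the $4\times4$-matrix whose $i$-th column is the $i$-th column of $A$ if $i\in I$ and the $i$-th column of $B$ if $i\notin I$. The projective principal minor map is $\phi:(A,B)\mapsto(\det(A_IB_{[4]\setminus I}))_{I\subseteq[4]}\in\mathbb{C}^{16}$, and $\mathcal{V}_4\subset\mathbb{P}^{15}$ is its image, regarded as a (closed, irreducible) projective variety. (With $B$ the identity matrix, the coordinates are the principal minors of $A$.) Here $\mathbb{P}^{15}=\mathbb{P}(\mathbb{C}^2\otimes\mathbb{C}^2\otimes\mathbb{C}^2\otimes\mathbb{C}^2)$ is the projective space of $2\times2\times2\times2$-tables $a=(a_{ijkl})_{i,j,k,l\in\{0,1\}}$, and the coordinate indexed by $I\subseteq[4]$ is identified with $a_{j_1j_2j_3j_4}$ where $j_i=1$ if $i\in I$ and $j_i=0$ otherwise. Definition of $\nabla_{\rm node}(\emptyset)$. For $a\in\mathbb{P}^{15}$ let $$\mathcal{H}_a=\Bigl\{(x,y,z,w)\in\mathbb{P}^1\times\mathbb{P}^1\times\mathbb{P}^1\times\mathbb{P}^1:\ \sum_{i,j,k,l=0}^1a_{ijkl}\,x_iy_jz_kw_l=0\Bigr\}.$$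 A singular point of $\mathcal{H}_a$ is a point of $(\mathbb{P}^1)^4$ at which the defining multilinear form and all its partial derivatives vanish. The hyperdeterminantal hypersurface $\nabla\subset\mathbb{P}^{15}$ consists of all tables $a$ such that $\mathcal{H}_a$ has a singular point. The node component $\nabla_{\rm node}(\emptyset)$, which is one of the irreducible components (of dimension $13$) of the singular locus of $\nabla$, is the closure in $\mathbb{P}^{15}$ of the set of tables $a$ such that $\mathcal{H}_a$ has two singular points $(x,y,z,w)$ and $(x',y',z',w')$ with $x\neq x'$, $y\neq y'$, $z\neq z'$ and $w\neq w'$. *)

theory Defs
  imports "HOL-Analysis.Analysis" "HOL-Library.Poly_Mapping"
begin

definition proportional :: "complex ^ 'n \<Rightarrow> complex ^ 'n \<Rightarrow> bool" where
  "proportional u v \<longleftrightarrow> u \<noteq> 0 \<and> v \<noteq> 0 \<and> (\<exists>c. c \<noteq> 0 \<and> v = c *s u)"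

lemma part_equivp_proportional: "part_equivp (proportional :: complex ^ 'n::finite \<Rightarrow> _)"
proof (rule part_equivpI)
  have "proportional (1 :: complex ^ 'n) 1"
    by (auto simp: proportional_def intro!: exI[of _ 1])
  then show "\<exists>u :: complex ^ 'n. proportional u u" ..
next
  show "symp (proportional :: complex ^ 'n \<Rightarrow> _)"
  proof (rule sympI)
    fix u v :: "complex ^ 'n"
    assume "proportional u v"
    then obtain c where c: "c \<noteq> 0" "v = c *s u" "u \<noteq> 0" "v \<noteq> 0"
      unfolding proportional_def by blast
    then have "u = inverse c *s v" by (simp add: vector_smult_assoc)
    with c show "proportional v u"
      unfolding proportional_def by (metis nonzero_imp_inverse_nonzero)
  qed
next
  show "transp (proportional :: complex ^ 'n \<Rightarrow> _)"
  proof (rule transpI)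
    fix u v w :: "complex ^ 'n"
    assume "proportional u v" "proportional v w"
    then show "proportional u w"
      unfolding proportional_def by (metis mult_eq_0_iff vector_smult_assoc)
  qed
qed

text \<open>\<open>'n proj\<close> has homogeneous coordinates indexed by \<open>'n\<close>; its dimension is \<open>CARD('n) - 1\<close>.
  The class of a nonzero vector \<open>v\<close> is \<open>abs_proj v\<close>; for \<open>v = 0\<close> this term is meaningless.\<close>

quotient_type 'n proj = "complex ^ 'n::finite" / partial: proportional
  by (rule part_equivp_proportional)

type_synonym 'n mpoly = "('n \<Rightarrow>\<^sub>0 nat) \<Rightarrow>\<^sub>0 complex"

definition mpoly_eval :: "'n::finite mpoly \<Rightarrow> complex ^ 'n \<Rightarrow> complex" where
  "mpoly_eval p v =
    (\<Sum>m \<in> Poly_Mapping.keys p.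
       Poly_Mapping.lookup p m * (\<Prod>i \<in> UNIV. v $ i ^ Poly_Mapping.lookup m i))"

definition homogeneous :: "'n::finite mpoly \<Rightarrow> bool" where
  "homogeneous p \<longleftrightarrow>
    (\<exists>d. \<forall>m \<in> Poly_Mapping.keys p. (\<Sum>i \<in> UNIV. Poly_Mapping.lookup m i) = d)"

definition zero_locus :: "'n::finite mpoly set \<Rightarrow> 'n proj set" where
  "zero_locus F = {abs_proj v | v. v \<noteq> 0 \<and> (\<forall>f \<in> F. mpoly_eval f v = 0)}"

text \<open>Infinite \<open>F\<close> are harmless by Hilbert's basis theorem.\<close>

definition zariski_closed :: "'n::finite proj set \<Rightarrow> bool" where
  "zariski_closed Z \<longleftrightarrow> (\<exists>F. (\<forall>f \<in> F. homogeneous f) \<and> Z = zero_locus F)"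

definition zariski_closure :: "'n::finite proj set \<Rightarrow> 'n proj set" where
  "zariski_closure S = zariski_closed hull S"

text \<open>The index types \<open>2\<close> and \<open>4\<close> are rings of residues, so that \<open>2\<close> has the
  elements \<open>0, 1\<close> and \<open>4\<close> has the elements \<open>1, 2, 3, 4\<close> (where \<open>4 = 0\<close>).\<close>

type_synonym table = "complex ^ (2 \<times> 2 \<times> 2 \<times> 2)"

definition mixed_minor :: "complex ^ 4 ^ 4 \<Rightarrow> complex ^ 4 ^ 4 \<Rightarrow> 4 set \<Rightarrow> complex" where
  "mixed_minor A B I = det (\<chi> r c. if c \<in> I then A $ r $ c else B $ r $ c)"

definition index_set :: "2 \<times> 2 \<times> 2 \<times> 2 \<Rightarrow> 4 set" where
  "index_set = (\<lambda>(j\<^sub>1, j\<^sub>2, j\<^sub>3, j\<^sub>4).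
     {i. i = 1 \<and> j\<^sub>1 = 1 \<or> i = 2 \<and> j\<^sub>2 = 1 \<or> i = 3 \<and> j\<^sub>3 = 1 \<or> i = 4 \<and> j\<^sub>4 = 1})"

definition principal_minor_map :: "complex ^ 4 ^ 4 \<Rightarrow> complex ^ 4 ^ 4 \<Rightarrow> table" where
  "principal_minor_map A B = (\<chi> j. mixed_minor A B (index_set j))"

text \<open>The map to projective space is only a rational map: it is undefined where all sixteen
  determinants vanish. As usual for rational maps, the image as a closed variety is the Zariski
  closure of the set of values.\<close>

definition V4 :: "(2 \<times> 2 \<times> 2 \<times> 2) proj set" where
  "V4 = zariski_closure
     {abs_proj (principal_minor_map A B) | A B. principal_minor_map A B \<noteq> 0}"

definition multilinear_form ::
  "table \<Rightarrow> complex ^ 2 \<Rightarrow> complex ^ 2 \<Rightarrow> complex ^ 2 \<Rightarrow> complex ^ 2 \<Rightarrow> complex" where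
  "multilinear_form a x y z w =
    (\<Sum>i\<in>UNIV. \<Sum>j\<in>UNIV. \<Sum>k\<in>UNIV. \<Sum>l\<in>UNIV. a $ (i, j, k, l) * x $ i * y $ j * z $ k * w $ l)"

definition singular_vectors ::
  "table \<Rightarrow> complex ^ 2 \<Rightarrow> complex ^ 2 \<Rightarrow> complex ^ 2 \<Rightarrow> complex ^ 2 \<Rightarrow> bool" where
  "singular_vectors a x y z w \<longleftrightarrow>
     multilinear_form a x y z w = 0 \<and>
     (\<forall>i. deriv (\<lambda>t. multilinear_form a (x + t *s axis i 1) y z w) 0 = 0 \<and>
          deriv (\<lambda>t. multilinear_form a x (y + t *s axis i 1) z w) 0 = 0 \<and>
          deriv (\<lambda>t. multilinear_form a x y (z + t *s axis i 1) w) 0 = 0 \<and>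
          deriv (\<lambda>t. multilinear_form a x y z (w + t *s axis i 1)) 0 = 0)"

lemma multilinear_form_add:
  "multilinear_form a (x + x') y z w = multilinear_form a x y z w + multilinear_form a x' y z w"
  "multilinear_form a x (y + y') z w = multilinear_form a x y z w + multilinear_form a x y' z w"
  "multilinear_form a x y (z + z') w = multilinear_form a x y z w + multilinear_form a x y z' w"
  "multilinear_form a x y z (w + w') = multilinear_form a x y z w + multilinear_form a x y z w'"
  by (simp_all add: multilinear_form_def sum.distrib [symmetric] algebra_simps)

lemma multilinear_form_scale:
  "multilinear_form (c *s a) x y z w = c * multilinear_form a x y z w"
  "multilinear_form a (c *s x) y z w = c * multilinear_form a x y z w"
  "multilinear_form a x (c *s y) z w = c * multilinear_form a x y z w"
  "multilinear_form a x y (c *s z) w = c * multilinear_form a x y z w"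
  "multilinear_form a x y z (c *s w) = c * multilinear_form a x y z w"
  by (simp_all add: multilinear_form_def sum_distrib_left mult_ac)

lemma deriv_affine: "deriv (\<lambda>t. p + t * q) (0 :: complex) = q"
  by (rule DERIV_imp_deriv) (auto intro!: derivative_eq_intros)

lemma singular_vectors_iff:
  "singular_vectors a x y z w \<longleftrightarrow>
     multilinear_form a x y z w = 0 \<and>
     (\<forall>i. multilinear_form a (axis i 1) y z w = 0 \<and> multilinear_form a x (axis i 1) z w = 0 \<and>
          multilinear_form a x y (axis i 1) w = 0 \<and> multilinear_form a x y z (axis i 1) = 0)"
  by (simp add: singular_vectors_def multilinear_form_add multilinear_form_scale deriv_affine)

lift_definition singular_point ::
  "(2 \<times> 2 \<times> 2 \<times> 2) proj \<Rightarrow> 2 proj \<times> 2 proj \<times> 2 proj \<times> 2 proj \<Rightarrow> bool"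
  is "\<lambda>a (x, y, z, w). singular_vectors a x y z w"
  by (auto simp: proportional_def singular_vectors_iff multilinear_form_scale)

definition node_component :: "(2 \<times> 2 \<times> 2 \<times> 2) proj set" where
  "node_component = zariski_closure
     {a. \<exists>x y z w x' y' z' w'.
           singular_point a (x, y, z, w) \<and> singular_point a (x', y', z', w') \<and>
           x \<noteq> x' \<and> y \<noteq> y' \<and> z \<noteq> z' \<and> w \<noteq> w'}"

end

theory Submission
  imports Defs
begin

text \<open>
  A table of the form \<open>principal_minor_map A B\<close> is the form \<open>det (L\<^sub>1 x, L\<^sub>2 y, L\<^sub>3 z, L\<^sub>4 w)\<close> of four
  lines \<open>L\<^sub>i\<close> in projective 3-space. Four general lines have two common transversals, and the four
  points on a transversal are any three of them collinear, hence form a singular point; this gives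
  the two nodes. They are found as eigenvectors of a 2 by 2 matrix, and the condition that
  the eigenvalues differ is a polynomial inequation that is not identically false, so node
  tables are dense among the tables of principal minors.

  Conversely, in coordinates adapted to the two nodes a node table has only its six entries of
  weight two. The lines through the points \<open>p\<^sub>i \<oplus> 0\<close> and \<open>0 \<oplus> q\<^sub>i\<close> of \<open>\<complex>\<^sup>2 \<oplus> \<complex>\<^sup>2\<close> produce the entries
  \<open>[p\<^sub>i p\<^sub>j] [q\<^sub>k q\<^sub>l]\<close>, and six prescribed nonzero entries are reached by solving one quadratic equation.

  Homogeneous polynomials are continuous, so both inclusions may be checked up to Euclidean limits.
\<close>

section \<open>Euclidean limits and Zariski closures\<close>

lemma proportional_refl: "v \<noteq> 0 \<Longrightarrow> proportional v v"
  unfolding proportional_def by (auto intro: exI [of _ 1])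

lemma abs_proj_eq_iff:
  assumes "u \<noteq> 0" "v \<noteq> 0"
  shows "abs_proj u = abs_proj v \<longleftrightarrow> (\<exists>c. c \<noteq> 0 \<and> v = c *s u)"
  using Quotient3_rel [OF Quotient3_proj, of u v] assms proportional_refl [of u] proportional_refl [of v]
  by (auto simp: proportional_def)

lemma proj_cases:
  obtains v where "v \<noteq> 0" "p = abs_proj v"
  by (induction p rule: proj.abs_induct) (auto simp: proportional_def)

lemma singular_point_abs_proj:
  assumes "a \<noteq> 0" "x \<noteq> 0" "y \<noteq> 0" "z \<noteq> 0" "w \<noteq> 0"
  shows "singular_point (abs_proj a) (abs_proj x, abs_proj y, abs_proj z, abs_proj w) \<longleftrightarrow>
    singular_vectors a x y z w"
  using singular_point.transfer [unfolded rel_fun_def, rule_format,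
     of a "abs_proj a" "(x, y, z, w)" "(abs_proj x, abs_proj y, abs_proj z, abs_proj w)"] assms
  by (simp add: cr_proj_def proportional_refl)

lemma mpoly_eval_scale:
  assumes "homogeneous f" "mpoly_eval f v = 0"
  shows "mpoly_eval f (c *s v) = 0"
proof -
  obtain d where d: "\<And>m. m \<in> Poly_Mapping.keys f \<Longrightarrow> (\<Sum>i\<in>UNIV. Poly_Mapping.lookup m i) = d"
    using assms(1) unfolding homogeneous_def by blast
  have "mpoly_eval f (c *s v) = c ^ d * mpoly_eval f v"
    unfolding mpoly_eval_def sum_distrib_left
  proof (rule sum.cong)
    fix m assume "m \<in> Poly_Mapping.keys f"
    have "(\<Prod>i\<in>UNIV. (c *s v) $ i ^ Poly_Mapping.lookup m i)
        = (\<Prod>i\<in>UNIV. c ^ Poly_Mapping.lookup m i) * (\<Prod>i\<in>UNIV. v $ i ^ Poly_Mapping.lookup m i)"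
      by (simp add: power_mult_distrib prod.distrib)
    also have "(\<Prod>i\<in>UNIV. c ^ Poly_Mapping.lookup m i) = c ^ d"
      using d [OF \<open>m \<in> _\<close>] by (simp flip: power_sum)
    finally show "Poly_Mapping.lookup f m * (\<Prod>i\<in>UNIV. (c *s v) $ i ^ Poly_Mapping.lookup m i) =
        c ^ d * (Poly_Mapping.lookup f m * (\<Prod>i\<in>UNIV. v $ i ^ Poly_Mapping.lookup m i))"
      by simp
  qed simp
  then show ?thesis using assms(2) by simp
qed

lemma continuous_on_mpoly_eval: "continuous_on S (mpoly_eval f)"
  unfolding mpoly_eval_def by (intro continuous_intros)

text \<open>Homogeneity makes vanishing independent of the chosen representative.\<close>

lemma abs_proj_in_zero_locus_iff:
  assumes "\<forall>f \<in> F. homogeneous f" "v \<noteq> 0"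
  shows "abs_proj v \<in> zero_locus F \<longleftrightarrow> (\<forall>f \<in> F. mpoly_eval f v = 0)"
proof
  assume "abs_proj v \<in> zero_locus F"
  then obtain u where u: "u \<noteq> 0" "abs_proj u = abs_proj v" "\<forall>f \<in> F. mpoly_eval f u = 0"
    unfolding zero_locus_def by auto
  then obtain c where "v = c *s u" using abs_proj_eq_iff [OF u(1) assms(2)] by auto
  with u assms(1) show "\<forall>f \<in> F. mpoly_eval f v = 0" by (simp add: mpoly_eval_scale)
qed (use assms in \<open>auto simp: zero_locus_def\<close>)

text \<open>Limits are taken among vectors, so no topology on projective space is needed: the zero
  set of a polynomial is closed in the vector space.\<close>

lemma zariski_closure_mono_closure:
  fixes S T :: "(complex ^ 'n) set"
  assumes "S \<subseteq> closure T"
  shows "zariski_closure (abs_proj ` (S - {0})) \<subseteq> zariski_closure (abs_proj ` (T - {0}))"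
  unfolding zariski_closure_def hull_def
proof (rule Inter_anti_mono, intro subsetI CollectI conjI)
  fix Z p
  assume Z: "Z \<in> {t. zariski_closed t \<and> abs_proj ` (T - {0}) \<subseteq> t}" and "p \<in> abs_proj ` (S - {0})"
  then obtain s where s: "s \<in> S" "s \<noteq> 0" "p = abs_proj s"
    and "zariski_closed Z" and T: "abs_proj ` (T - {0}) \<subseteq> Z"
    by blast
  then obtain F where F: "\<forall>f \<in> F. homogeneous f" "Z = zero_locus F"
    unfolding zariski_closed_def by blast
  show "p \<in> Z"
    unfolding \<open>p = _\<close> F(2) abs_proj_in_zero_locus_iff [OF F(1) \<open>s \<noteq> 0\<close>]
  proof
    fix f assume "f \<in> F"
    have "T - {0} \<subseteq> {v. mpoly_eval f v = 0}"
      using T abs_proj_in_zero_locus_iff [OF F(1)] \<open>f \<in> F\<close> unfolding F(2) by blast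
    moreover have "closed {v. mpoly_eval f v = 0}"
      by (intro closed_Collect_eq continuous_on_mpoly_eval continuous_on_const)
    ultimately have "closure (T - {0}) \<subseteq> {v. mpoly_eval f v = 0}"
      by (rule closure_minimal)
    \<comment> \<open>Deleting \<open>0\<close> from \<open>T\<close> can remove at most
      \<open>0\<close> from the closure, and \<open>s\<close> is nonzero.\<close>
    moreover have "s \<in> closure (T - {0})"
      using assms s closure_insert [of 0 "T - {0}"] closure_mono [of T "insert 0 (T - {0})"]
      by auto
    ultimately show "mpoly_eval f s = 0" by blast
  qed
qed simp

section \<open>Four lines in projective space\<close>

definition det4 :: "'a::comm_ring_1 ^ 4 \<Rightarrow> 'a ^ 4 \<Rightarrow> 'a ^ 4 \<Rightarrow> 'a ^ 4 \<Rightarrow> 'a" where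
  "det4 p q r s = det (\<chi> i j. if j = 1 then p $ i else if j = 2 then q $ i else if j = 3 then r $ i else s $ i)"

lemma det_4:
  "det (A :: 'a::comm_ring_1 ^ 4 ^ 4) =
    A$1$1 * (A$2$2 * (A$3$3 * A$4$4 - A$3$4 * A$4$3) - A$2$3 * (A$3$2 * A$4$4 - A$3$4 * A$4$2)
      + A$2$4 * (A$3$2 * A$4$3 - A$3$3 * A$4$2))
    - A$1$2 * (A$2$1 * (A$3$3 * A$4$4 - A$3$4 * A$4$3) - A$2$3 * (A$3$1 * A$4$4 - A$3$4 * A$4$1)
      + A$2$4 * (A$3$1 * A$4$3 - A$3$3 * A$4$1))
    + A$1$3 * (A$2$1 * (A$3$2 * A$4$4 - A$3$4 * A$4$2) - A$2$2 * (A$3$1 * A$4$4 - A$3$4 * A$4$1)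
      + A$2$4 * (A$3$1 * A$4$2 - A$3$2 * A$4$1))
    - A$1$4 * (A$2$1 * (A$3$2 * A$4$3 - A$3$3 * A$4$2) - A$2$2 * (A$3$1 * A$4$3 - A$3$3 * A$4$1)
      + A$2$3 * (A$3$1 * A$4$2 - A$3$2 * A$4$1))"
proof -
  have f: "finite {2::4, 3, 4}" "1 \<notin> {2::4, 3, 4}" "finite {3::4, 4}" "2 \<notin> {3::4, 4}"
     "finite {4::4}" "3 \<notin> {4::4}" by auto
  show ?thesis
    unfolding det_def UNIV_4
    unfolding sum_over_permutations_insert [OF f(1,2)]
    unfolding sum_over_permutations_insert [OF f(3,4)]
    unfolding sum_over_permutations_insert [OF f(5,6)]
    unfolding permutes_sing
    by (simp add: sign_swap_id permutation_swap_id sign_compose permutation_compose sign_id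
        swap_id_eq algebra_simps)
qed

lemmas det4_expand = det4_def det_4

lemma det4_add:
  "det4 (p + p') q r s = det4 p q r s + det4 p' q r s"
  "det4 p (q + q') r s = det4 p q r s + det4 p q' r s"
  "det4 p q (r + r') s = det4 p q r s + det4 p q r' s"
  "det4 p q r (s + s') = det4 p q r s + det4 p q r s'"
  by (simp_all add: det4_expand algebra_simps)

lemma det4_scale:
  "det4 (c *s p) q r s = c * det4 p q r s"
  "det4 p (c *s q) r s = c * det4 p q r s"
  "det4 p q (c *s r) s = c * det4 p q r s"
  "det4 p q r (c *s s) = c * det4 p q r s"
  by (simp_all add: det4_expand algebra_simps)

lemma det4_repeat:
  "det4 p p r s = 0" "det4 p q p s = 0" "det4 p q r p = 0"
  "det4 p q q s = 0" "det4 p q r q = 0" "det4 p q r r = 0"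
  by (simp_all add: det4_expand algebra_simps)

text \<open>\<open>r\<close> and \<open>s\<close> lie in the span of \<open>p\<close> and
  \<open>q\<close>, so any three of the four vectors are dependent. The factor \<open>a\<close>
  clears the denominators of Cramer's rule.\<close>

lemma det4_collinear:
  fixes p q r s :: "'a::field ^ 4"
  assumes "a \<noteq> 0" and r: "a *s r = p + q" and s: "a *s s = b *s p + c *s q"
  shows "det4 v q r s = 0" "det4 p v r s = 0" "det4 p q v s = 0" "det4 p q r v = 0"
proof -
  have "a * (a * det4 v q r s) = det4 v q (a *s r) (a *s s)" by (simp add: det4_scale)
  also have "\<dots> = 0" unfolding r s by (simp add: det4_add det4_scale det4_repeat)
  finally show "det4 v q r s = 0" using \<open>a \<noteq> 0\<close> by simp
  have "a * (a * det4 p v r s) = det4 p v (a *s r) (a *s s)" by (simp add: det4_scale)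
  also have "\<dots> = 0" unfolding r s by (simp add: det4_add det4_scale det4_repeat)
  finally show "det4 p v r s = 0" using \<open>a \<noteq> 0\<close> by simp
  have "a * det4 p q v s = det4 p q v (a *s s)" by (simp add: det4_scale)
  also have "\<dots> = 0" unfolding s by (simp add: det4_add det4_scale det4_repeat)
  finally show "det4 p q v s = 0" using \<open>a \<noteq> 0\<close> by simp
  have "a * det4 p q r v = det4 p q (a *s r) v" by (simp add: det4_scale)
  also have "\<dots> = 0" unfolding r by (simp add: det4_add det4_scale det4_repeat)
  finally show "det4 p q r v = 0" using \<open>a \<noteq> 0\<close> by simp
qed

text \<open>In the type \<open>2\<close> the index \<open>2\<close> equals \<open>0\<close>, so
  \<open>x $ 2\<close> is the coordinate belonging to \<open>B\<close>.\<close>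

definition column_line :: "complex ^ 4 ^ 4 \<Rightarrow> complex ^ 4 ^ 4 \<Rightarrow> 4 \<Rightarrow> complex ^ 2 \<Rightarrow> complex ^ 4" where
  "column_line A B c x = x $ 1 *s column c A + x $ 2 *s column c B"

lemma principal_minor_map_nth:
  "principal_minor_map A B $ (i, j, k, l) =
    det4 (if i = 1 then column 1 A else column 1 B) (if j = 1 then column 2 A else column 2 B)
      (if k = 1 then column 3 A else column 3 B) (if l = 1 then column 4 A else column 4 B)"
  unfolding principal_minor_map_def mixed_minor_def det4_def
  by (auto simp: index_set_def column_def vec_eq_iff forall_4 intro!: arg_cong [where f = det])

lemma multilinear_form_principal_minor_map:
  "multilinear_form (principal_minor_map A B) x y z w =
    det4 (column_line A B 1 x) (column_line A B 2 y) (column_line A B 3 z) (column_line A B 4 w)"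
  unfolding multilinear_form_def column_line_def
  by (simp add: sum_2 principal_minor_map_nth det4_add det4_scale algebra_simps)

text \<open>The four points lie on a common line. Replacing one of them by an arbitrary vector
  leaves three collinear points, so all partial derivatives vanish.\<close>

lemma singular_vectors_of_transversal:
  assumes "d \<noteq> 0"
    and "d *s column_line A B 3 z = column_line A B 1 x + column_line A B 2 y"
    and "d *s column_line A B 4 w = b *s column_line A B 1 x + c *s column_line A B 2 y"
  shows "singular_vectors (principal_minor_map A B) x y z w"
  unfolding singular_vectors_iff multilinear_form_principal_minor_map
  using det4_collinear [OF assms] by blast

section \<open>Normal form of node tables\<close>

definition det2 :: "'a::comm_ring_1 ^ 2 \<Rightarrow> 'a ^ 2 \<Rightarrow> 'a" where
  "det2 u v = u $ 1 * v $ 2 - u $ 2 * v $ 1"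

lemma abs_proj_eq_iff_det2:
  fixes u v :: "complex ^ 2"
  assumes "u \<noteq> 0" "v \<noteq> 0"
  shows "abs_proj u = abs_proj v \<longleftrightarrow> det2 u v = 0"
proof
  assume "abs_proj u = abs_proj v"
  then show "det2 u v = 0"
    unfolding abs_proj_eq_iff [OF assms] by (auto simp: det2_def)
next
  assume 0: "det2 u v = 0"
  obtain c where "v = c *s u"
  proof (cases "u $ 1 = 0")
    case True
    with \<open>u \<noteq> 0\<close> have "u $ 2 \<noteq> 0" by (auto simp: vec_eq_iff forall_2)
    with True 0 have "v = (v $ 2 / u $ 2) *s u" by (auto simp: vec_eq_iff forall_2 det2_def)
    then show thesis by (rule that)
  next
    case False
    with 0 have "v = (v $ 1 / u $ 1) *s u" by (auto simp: vec_eq_iff forall_2 det2_def field_simps)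
    then show thesis by (rule that)
  qed
  with \<open>v \<noteq> 0\<close> show "abs_proj u = abs_proj v"
    unfolding abs_proj_eq_iff [OF assms] by (intro exI [of _ c]) auto
qed

lemma det2_nonzeroD: "det2 u v \<noteq> 0 \<Longrightarrow> u \<noteq> 0 \<and> v \<noteq> 0"
  by (auto simp: det2_def)

text \<open>A cone of vectors, with the zero table included. The \<open>det2\<close> conditions say
  both that the representatives are nonzero and that the points are distinct.\<close>

definition node_tables :: "table set" where
  "node_tables = {a. \<exists>x y z w x' y' z' w'.
     singular_vectors a x y z w \<and> singular_vectors a x' y' z' w' \<and>
     det2 x x' \<noteq> 0 \<and> det2 y y' \<noteq> 0 \<and> det2 z z' \<noteq> 0 \<and> det2 w w' \<noteq> 0}"

lemma node_component_eq: "node_component = zariski_closure (abs_proj ` (node_tables - {0}))"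
proof -
  have "{a. \<exists>x y z w x' y' z' w'.
           singular_point a (x, y, z, w) \<and> singular_point a (x', y', z', w') \<and>
           x \<noteq> x' \<and> y \<noteq> y' \<and> z \<noteq> z' \<and> w \<noteq> w'} = abs_proj ` (node_tables - {0})" (is "?L = ?R")
  proof (intro equalityI subsetI)
    fix p assume "p \<in> ?L"
    then obtain X Y Z W X' Y' Z' W' where
      *: "singular_point p (X, Y, Z, W)" "singular_point p (X', Y', Z', W')"
      "X \<noteq> X'" "Y \<noteq> Y'" "Z \<noteq> Z'" "W \<noteq> W'" by blast
    obtain a where a: "a \<noteq> 0" "p = abs_proj a" by (rule proj_cases)
    obtain x where x: "x \<noteq> 0" "X = abs_proj x" by (rule proj_cases)
    obtain y where y: "y \<noteq> 0" "Y = abs_proj y" by (rule proj_cases)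
    obtain z where z: "z \<noteq> 0" "Z = abs_proj z" by (rule proj_cases)
    obtain w where w: "w \<noteq> 0" "W = abs_proj w" by (rule proj_cases)
    obtain x' where x': "x' \<noteq> 0" "X' = abs_proj x'" by (rule proj_cases)
    obtain y' where y': "y' \<noteq> 0" "Y' = abs_proj y'" by (rule proj_cases)
    obtain z' where z': "z' \<noteq> 0" "Z' = abs_proj z'" by (rule proj_cases)
    obtain w' where w': "w' \<noteq> 0" "W' = abs_proj w'" by (rule proj_cases)
    have "singular_vectors a x y z w" "singular_vectors a x' y' z' w'"
      "det2 x x' \<noteq> 0" "det2 y y' \<noteq> 0" "det2 z z' \<noteq> 0" "det2 w w' \<noteq> 0"
      using * a x y z w x' y' z' w'
      by (simp_all add: singular_point_abs_proj abs_proj_eq_iff_det2)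
    then have "a \<in> node_tables" unfolding node_tables_def by blast
    with a show "p \<in> ?R" by blast
  next
    fix p assume "p \<in> ?R"
    then obtain a x y z w x' y' z' w' where a: "a \<noteq> 0" "p = abs_proj a"
      and *: "singular_vectors a x y z w" "singular_vectors a x' y' z' w'"
       "det2 x x' \<noteq> 0" "det2 y y' \<noteq> 0" "det2 z z' \<noteq> 0" "det2 w w' \<noteq> 0"
      unfolding node_tables_def by blast
    moreover note *(3-6) [THEN det2_nonzeroD]
    ultimately have "singular_point p (abs_proj x, abs_proj y, abs_proj z, abs_proj w)"
      "singular_point p (abs_proj x', abs_proj y', abs_proj z', abs_proj w')"
      "abs_proj x \<noteq> abs_proj x'" "abs_proj y \<noteq> abs_proj y'"
      "abs_proj z \<noteq> abs_proj z'" "abs_proj w \<noteq> abs_proj w'"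
      by (auto simp: singular_point_abs_proj abs_proj_eq_iff_det2)
    then show "p \<in> ?L" by blast
  qed
  then show ?thesis unfolding node_component_def by simp
qed

definition principal_minor_tables :: "table set" where
  "principal_minor_tables = {principal_minor_map A B | A B. True}"

lemma V4_eq: "V4 = zariski_closure (abs_proj ` (principal_minor_tables - {0}))"
  unfolding V4_def principal_minor_tables_def by (intro arg_cong [where f = zariski_closure]) auto

lemma table_nth: "a $ (i, j, k, l) = multilinear_form a (axis i 1) (axis j 1) (axis k 1) (axis l 1)"
  using exhaust_2 [of i] exhaust_2 [of j] exhaust_2 [of k] exhaust_2 [of l]
  by (elim disjE) (simp_all add: multilinear_form_def axis_def sum_2)

lemma dual_basis_2:
  fixes x x' :: "'a::field ^ 2"
  assumes "det2 x x' \<noteq> 0"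
  obtains s s' :: "'a ^ 2" where "\<And>i. axis i 1 = s $ i *s x + s' $ i *s x'"
proof
  \<comment> \<open>Cramer's rule: \<open>s $ i\<close> is
    \<open>det2 (axis i 1) x' / det2 x x'\<close>, and \<open>s' $ i\<close> is
    \<open>det2 x (axis i 1) / det2 x x'\<close>.\<close>
  define s s' :: "'a ^ 2"
    where "s = (\<chi> i. (if i = 1 then x' $ 2 else - x' $ 1) / det2 x x')"
      and "s' = (\<chi> i. (if i = 1 then - x $ 2 else x $ 1) / det2 x x')"
  fix i :: 2
  show "axis i 1 = s $ i *s x + s' $ i *s x'"
    using exhaust_2 [of i] assms
    by (auto simp: s_def s'_def vec_eq_iff forall_2 axis_def divide_simps) (auto simp: det2_def algebra_simps)
qed

lemma singular_vectors_multilinear_form: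
  assumes "singular_vectors a x y z w"
  shows "multilinear_form a v y z w = 0" "multilinear_form a x v z w = 0"
    "multilinear_form a x y v w = 0" "multilinear_form a x y z v = 0"
proof -
  have v: "v = v $ 1 *s axis 1 1 + v $ 2 *s axis 2 1"
    by (simp add: vec_eq_iff forall_2 axis_def)
  show "multilinear_form a v y z w = 0" "multilinear_form a x v z w = 0"
    "multilinear_form a x y v w = 0" "multilinear_form a x y z v = 0"
    using assms unfolding singular_vectors_iff
    by (subst v, simp add: multilinear_form_add multilinear_form_scale)+
qed

text \<open>The six scalars are the coefficients of weight two in a basis of \<open>(\<complex>\<^sup>2)\<^sup>4\<close> adapted to the two nodes;
  all other coefficients vanish. In the adapted basis \<open>s\<close> and \<open>s'\<close> are the coordinate functions.\<close>

definition node_form :: "complex ^ 2 \<Rightarrow> complex ^ 2 \<Rightarrow> complex ^ 2 \<Rightarrow> complex ^ 2 \<Rightarrow>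
    complex ^ 2 \<Rightarrow> complex ^ 2 \<Rightarrow> complex ^ 2 \<Rightarrow> complex ^ 2 \<Rightarrow>
    complex \<Rightarrow> complex \<Rightarrow> complex \<Rightarrow> complex \<Rightarrow> complex \<Rightarrow> complex \<Rightarrow> table" where
  "node_form s s' t t' u u' v v' b12 b34 b13 b24 b14 b23 = (\<chi> m. case m of (i, j, k, l) \<Rightarrow>
     b12 * s $ i * t $ j * u' $ k * v' $ l + b34 * s' $ i * t' $ j * u $ k * v $ l +
     b13 * s $ i * t' $ j * u $ k * v' $ l + b24 * s' $ i * t $ j * u' $ k * v $ l +
     b14 * s $ i * t' $ j * u' $ k * v $ l + b23 * s' $ i * t $ j * u $ k * v' $ l)"

text \<open>Expand the form in the bases given by the two nodes. A coefficient with at least three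
  arguments from the same node vanishes, which leaves six of sixteen.\<close>

lemma node_tables_normal_form:
  assumes "a \<in> node_tables"
  obtains s s' t t' u u' v v' b12 b34 b13 b24 b14 b23
  where "a = node_form s s' t t' u u' v v' b12 b34 b13 b24 b14 b23"
proof -
  obtain x y z w x' y' z' w'
    where sing: "singular_vectors a x y z w" "singular_vectors a x' y' z' w'"
      and *: "det2 x x' \<noteq> 0" "det2 y y' \<noteq> 0" "det2 z z' \<noteq> 0" "det2 w w' \<noteq> 0"
    using assms unfolding node_tables_def by blast
  obtain s s' where s: "\<And>i. axis i 1 = s $ i *s x + s' $ i *s x'"
    using dual_basis_2 [OF *(1)] by blast
  obtain t t' where t: "\<And>i. axis i 1 = t $ i *s y + t' $ i *s y'"
    using dual_basis_2 [OF *(2)] by blast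
  obtain u u' where u: "\<And>i. axis i 1 = u $ i *s z + u' $ i *s z'"
    using dual_basis_2 [OF *(3)] by blast
  obtain v v' where v: "\<And>i. axis i 1 = v $ i *s w + v' $ i *s w'"
    using dual_basis_2 [OF *(4)] by blast
  let ?F = "multilinear_form a"
  have "a = node_form s s' t t' u u' v v' (?F x y z' w') (?F x' y' z w) (?F x y' z w') (?F x' y z' w)
      (?F x y' z' w) (?F x' y z w')"
    unfolding vec_eq_iff
  proof clarify
    fix i j k l :: 2
    have "a $ (i, j, k, l) = ?F (s $ i *s x + s' $ i *s x') (t $ j *s y + t' $ j *s y')
        (u $ k *s z + u' $ k *s z') (v $ l *s w + v' $ l *s w')"
      unfolding s [symmetric] t [symmetric] u [symmetric] v [symmetric] by (rule table_nth)
    then show "a $ (i, j, k, l) = node_form s s' t t' u u' v v' (?F x y z' w') (?F x' y' z w)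
      (?F x y' z w') (?F x' y z' w) (?F x y' z' w) (?F x' y z w') $ (i, j, k, l)"
      by (simp add: node_form_def multilinear_form_add multilinear_form_scale
          singular_vectors_multilinear_form [OF sing(1)]
          singular_vectors_multilinear_form [OF sing(2)] algebra_simps)
  qed
  then show thesis by (rule that)
qed

section \<open>Realizing node forms by lines that meet two skew lines\<close>

definition block_vec :: "'a \<Rightarrow> 'a \<Rightarrow> 'a ^ 2 \<Rightarrow> 'a ^ 2 \<Rightarrow> 'a::comm_ring_1 ^ 4" where
  "block_vec c d p q = (\<chi> r. if r = 1 then c * p $ 1 else if r = 2 then c * p $ 2
     else if r = 3 then d * q $ 1 else d * q $ 2)"

text \<open>Laplace expansion along the first two rows: one term for each choice of two
  columns.\<close>

lemma det4_block_vec: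
  "det4 (block_vec c1 d1 p1 q1) (block_vec c2 d2 p2 q2) (block_vec c3 d3 p3 q3) (block_vec c4 d4 p4 q4) =
    (det2 p1 p2 * det2 q3 q4) * c1 * c2 * d3 * d4 + (det2 p3 p4 * det2 q1 q2) * d1 * d2 * c3 * c4 -
    (det2 p1 p3 * det2 q2 q4) * c1 * d2 * c3 * d4 - (det2 p2 p4 * det2 q1 q3) * d1 * c2 * d3 * c4 +
    (det2 p1 p4 * det2 q2 q3) * c1 * d2 * d3 * c4 + (det2 p2 p3 * det2 q1 q4) * d1 * c2 * c3 * d4"
  unfolding det4_expand block_vec_def det2_def by (simp add: algebra_simps)

lemma node_form_in_principal_minor_tables:
  "node_form s s' t t' u u' v v'
     (det2 p1 p2 * det2 q3 q4) (det2 p3 p4 * det2 q1 q2)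
     (- (det2 p1 p3 * det2 q2 q4)) (- (det2 p2 p4 * det2 q1 q3))
     (det2 p1 p4 * det2 q2 q3) (det2 p2 p3 * det2 q1 q4) \<in> principal_minor_tables" (is "?N \<in> _")
proof -
  \<comment> \<open>\<open>C 1\<close> serves as \<open>A\<close> and \<open>C 2\<close> as
    \<open>B\<close>; the adapted coordinates of the axis vectors become the block
    coefficients.\<close>
  define C where "C = (\<lambda>i. \<chi> r (c :: 4). (if c = 1 then block_vec (s $ i) (s' $ i) p1 q1
    else if c = 2 then block_vec (t $ i) (t' $ i) p2 q2
    else if c = 3 then block_vec (u $ i) (u' $ i) p3 q3
    else block_vec (v $ i) (v' $ i) p4 q4) $ r)"
  have col: "column 1 (C i) = block_vec (s $ i) (s' $ i) p1 q1"
    "column 2 (C i) = block_vec (t $ i) (t' $ i) p2 q2"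
    "column 3 (C i) = block_vec (u $ i) (u' $ i) p3 q3"
    "column 4 (C i) = block_vec (v $ i) (v' $ i) p4 q4" for i
    by (simp_all add: C_def column_def vec_eq_iff)
  have sel: "(if i = 1 then column c (C 1) else column c (C 2)) = column c (C i)" for i :: 2 and c
    using exhaust_2 [of i] by auto
  have "?N = principal_minor_map (C 1) (C 2)"
    unfolding vec_eq_iff
  proof clarify
    fix i j k l :: 2
    show "?N $ (i, j, k, l) = principal_minor_map (C 1) (C 2) $ (i, j, k, l)"
      unfolding principal_minor_map_nth sel
      unfolding col det4_block_vec
      by (simp add: node_form_def algebra_simps)
  qed
  then show ?thesis unfolding principal_minor_tables_def by blast
qed

lemma complex_quadratic_root:
  fixes a b c :: complex
  assumes "a \<noteq> 0"
  obtains x where "a * x\<^sup>2 + b * x + c = 0"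
proof
  let ?x = "(csqrt (b\<^sup>2 - 4 * a * c) - b) / (2 * a)"
  have "4 * a * (a * ?x\<^sup>2 + b * ?x + c) = (2 * a * ?x + b)\<^sup>2 - (b\<^sup>2 - 4 * a * c)"
    by algebra
  also have "2 * a * ?x + b = csqrt (b\<^sup>2 - 4 * a * c)" using assms by simp
  finally show "a * ?x\<^sup>2 + b * ?x + c = 0" using assms by simp
qed

text \<open>Normalise \<open>p\<close> to \<open>(1, 0), (0, 1), (1, 1), (1, x)\<close>. Then the six brackets of \<open>q\<close> are
  determined, and their Pluecker relation is a quadratic equation for \<open>x\<close>.\<close>

lemma ex_brackets:
  fixes b12 b34 b13 b24 b14 b23 :: complex
  assumes nz: "b12 \<noteq> 0" "b34 \<noteq> 0" "b13 \<noteq> 0" "b24 \<noteq> 0" "b14 \<noteq> 0" "b23 \<noteq> 0"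
  obtains p1 p2 p3 p4 q1 q2 q3 q4 where
    "b12 = det2 p1 p2 * det2 q3 q4" "b34 = det2 p3 p4 * det2 q1 q2"
    "b13 = - (det2 p1 p3 * det2 q2 q4)" "b24 = - (det2 p2 p4 * det2 q1 q3)"
    "b14 = det2 p1 p4 * det2 q2 q3" "b23 = det2 p2 p3 * det2 q1 q4"
proof -
  let ?a = "b12 * b34" and ?b = "b13 * b24" and ?c = "b14 * b23"
  obtain x where x: "?b * x\<^sup>2 + (?a - ?b - ?c) * x + ?c = 0"
    using complex_quadratic_root [of ?b] nz by (metis mult_eq_0_iff)
  \<comment> \<open>The quadratic takes the nonzero values \<open>b14 * b23\<close> at 0 and
    \<open>b12 * b34\<close> at 1.\<close>
  have "x \<noteq> 0" "x \<noteq> 1" using x nz by auto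
  \<comment> \<open>Prescribed brackets of \<open>q\<close>: each \<open>b\<close>, up to sign,
    divided by the complementary bracket of \<open>p\<close>.\<close>
  define q12 q13 q14 q23 q24 q34 where q: "q12 = b34 / (x - 1)" "q13 = b24" "q14 = - b23"
    "q23 = b14 / x" "q24 = - b13" "q34 = b12"
  have "q12 \<noteq> 0" using nz \<open>x \<noteq> 1\<close> by (simp add: q)
  have "x * (x - 1) * (q12 * q34 - q13 * q24 + q14 * q23) = ?b * x\<^sup>2 + (?a - ?b - ?c) * x + ?c"
    using \<open>x \<noteq> 0\<close> \<open>x \<noteq> 1\<close> by (simp add: q field_simps power2_eq_square)
  with x \<open>x \<noteq> 0\<close> \<open>x \<noteq> 1\<close> have pl: "q12 * q34 - q13 * q24 + q14 * q23 = 0" by simp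
  define P :: "complex \<Rightarrow> complex \<Rightarrow> complex ^ 2" where "P = (\<lambda>g h. \<chi> i. if i = 1 then g else h)"
  have P: "det2 (P g h) (P g' h') = g * h' - h * g'" for g h g' h'
    by (simp add: det2_def P_def)
  show thesis
  proof (rule that)
    \<comment> \<open>After \<open>q1 = (1, 0)\<close> and \<open>q2 = (0, q12)\<close>, brackets
      with these two determine \<open>q3\<close> and \<open>q4\<close>. Only the bracket of
      \<open>q3\<close> and \<open>q4\<close> uses the Pluecker relation.\<close>
    show "b12 = det2 (P 1 0) (P 0 1) * det2 (P (- q23 / q12) q13) (P (- q24 / q12) q14)"
      using pl \<open>q12 \<noteq> 0\<close> unfolding P q(6) [symmetric] by (simp add: field_simps)
    show "b34 = det2 (P 1 1) (P 1 x) * det2 (P 1 0) (P 0 q12)"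
      using \<open>x \<noteq> 1\<close> unfolding P by (simp add: q)
    show "b13 = - (det2 (P 1 0) (P 1 1) * det2 (P 0 q12) (P (- q24 / q12) q14))"
      using \<open>q12 \<noteq> 0\<close> unfolding P by (simp add: q(5))
    show "b24 = - (det2 (P 0 1) (P 1 x) * det2 (P 1 0) (P (- q23 / q12) q13))"
      unfolding P by (simp add: q(2))
    show "b14 = det2 (P 1 0) (P 1 x) * det2 (P 0 q12) (P (- q23 / q12) q13)"
      using \<open>q12 \<noteq> 0\<close> \<open>x \<noteq> 0\<close> unfolding P by (simp add: q(4))
    show "b23 = det2 (P 0 1) (P 1 1) * det2 (P 1 0) (P (- q24 / q12) q14)"
      unfolding P by (simp add: q(3))
  qed
qed

lemma node_tables_subset: "node_tables \<subseteq> closure principal_minor_tables"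
proof
  fix a assume "a \<in> node_tables"
  then obtain s s' t t' u u' v v' b12 b34 b13 b24 b14 b23
    where a: "a = node_form s s' t t' u u' v v' b12 b34 b13 b24 b14 b23"
    by (rule node_tables_normal_form)
  \<comment> \<open>Zero coefficients are perturbed, since \<open>ex_brackets\<close> requires all
    six to be nonzero. \<open>Suc n\<close> matters because \<open>inverse 0 = 0\<close>.\<close>
  define g :: "complex \<Rightarrow> nat \<Rightarrow> complex"
    where "g = (\<lambda>b n. if b = 0 then inverse (of_nat (Suc n)) else b)"
  have g0: "g b n \<noteq> 0" for b n by (simp add: g_def del: of_nat_Suc)
  have lim: "g b \<longlonglongrightarrow> b" for b
    using LIMSEQ_inverse_real_of_nat [THEN tendsto_of_real, where 'a = complex]
    by (cases "b = 0") (simp_all add: g_def)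
  let ?a = "\<lambda>n. node_form s s' t t' u u' v v' (g b12 n) (g b34 n) (g b13 n) (g b24 n) (g b14 n) (g b23 n)"
  have "?a n \<in> principal_minor_tables" for n
  proof -
    obtain p1 p2 p3 p4 q1 q2 q3 q4 where
      "g b12 n = det2 p1 p2 * det2 q3 q4" "g b34 n = det2 p3 p4 * det2 q1 q2"
      "g b13 n = - (det2 p1 p3 * det2 q2 q4)" "g b24 n = - (det2 p2 p4 * det2 q1 q3)"
      "g b14 n = det2 p1 p4 * det2 q2 q3" "g b23 n = det2 p2 p3 * det2 q1 q4"
      by (rule ex_brackets [OF g0 g0 g0 g0 g0 g0])
    then show ?thesis by (simp only: node_form_in_principal_minor_tables)
  qed
  moreover have "?a \<longlonglongrightarrow> a"
    unfolding a node_form_def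
    by (intro vec_tendstoI) (auto split: prod.split intro!: tendsto_intros lim)
  ultimately show "a \<in> closure principal_minor_tables"
    unfolding closure_sequential by (intro exI [of _ ?a]) blast
qed

section \<open>Transversals of four general lines\<close>

lemma column_line_scale: "column_line A B i (c *s x) = c *s column_line A B i x"
  by (simp add: column_line_def vec_eq_iff algebra_simps)

definition adj2 :: "'a::comm_ring_1 ^ 2 ^ 2 \<Rightarrow> 'a ^ 2 ^ 2" where
  "adj2 M = (\<chi> i j. if i = j then (if i = 1 then M $ 2 $ 2 else M $ 1 $ 1) else - M $ i $ j)"

lemma adj2_nth: "adj2 M $ 1 $ 1 = M $ 2 $ 2" "adj2 M $ 1 $ 2 = - M $ 1 $ 2"
  "adj2 M $ 2 $ 1 = - M $ 2 $ 1" "adj2 M $ 2 $ 2 = M $ 1 $ 1"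
  by (simp_all add: adj2_def)

lemma matrix_adj2_cancel: "M *v (adj2 M *v x) = det M *s x"
  by (simp add: vec_eq_iff forall_2 matrix_vector_mult_def sum_2 adj2_nth det_2 algebra_simps)

lemma det_adj2: "det (adj2 M) = det M"
  by (simp add: det_2 adj2_nth)

lemma det2_matrix_vector_mult: "det2 (M *v x) (M *v y) = det M * det2 x y"
  by (simp add: det2_def det_2 matrix_vector_mult_def sum_2 algebra_simps)

text \<open>The second hypothesis is a nonzero discriminant of the characteristic polynomial. As
  \<open>M $ 1 $ 2\<close> is nonzero, an eigenvalue \<open>k\<close> has the explicit eigenvector
  \<open>(M $ 1 $ 2, k - M $ 1 $ 1)\<close>.\<close>

lemma two_eigenvectors:
  fixes M :: "complex ^ 2 ^ 2"
  assumes "M $ 1 $ 2 \<noteq> 0" and disc: "(M $ 1 $ 1 - M $ 2 $ 2)\<^sup>2 + 4 * M $ 1 $ 2 * M $ 2 $ 1 \<noteq> 0"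
  obtains z z' k k' where "det2 z z' \<noteq> 0" "M *v z = k *s z" "M *v z' = k' *s z'"
proof -
  define r where "r = csqrt ((M $ 1 $ 1 - M $ 2 $ 2)\<^sup>2 + 4 * M $ 1 $ 2 * M $ 2 $ 1)"
  have r: "r\<^sup>2 = (M $ 1 $ 1 - M $ 2 $ 2)\<^sup>2 + 4 * M $ 1 $ 2 * M $ 2 $ 1" "r \<noteq> 0"
    using disc by (simp_all add: r_def)
  define Z :: "complex \<Rightarrow> complex ^ 2" where "Z = (\<lambda>k. \<chi> i. if i = 1 then M $ 1 $ 2 else k - M $ 1 $ 1)"
  have eig: "M *v Z k = k *s Z k" if "(2 * k - M $ 1 $ 1 - M $ 2 $ 2)\<^sup>2 = r\<^sup>2" for k
  proof -
    \<comment> \<open>Four times the second row of the eigenvector equation; the first row is an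
      identity.\<close>
    have "4 * (M $ 2 $ 1 * M $ 1 $ 2 + M $ 2 $ 2 * (k - M $ 1 $ 1)) = 4 * (k * (k - M $ 1 $ 1))"
      using that unfolding r(1) by (simp add: power2_eq_square algebra_simps)
    then have "M $ 2 $ 1 * M $ 1 $ 2 + M $ 2 $ 2 * (k - M $ 1 $ 1) = k * (k - M $ 1 $ 1)"
      by (simp only: mult_cancel_left) simp
    then show ?thesis
      by (simp add: Z_def vec_eq_iff forall_2 matrix_vector_mult_def sum_2 algebra_simps)
  qed
  let ?k = "(M $ 1 $ 1 + M $ 2 $ 2 + r) / 2" and ?k' = "(M $ 1 $ 1 + M $ 2 $ 2 - r) / 2"
  show thesis
  proof (rule that)
    have "det2 (Z ?k) (Z ?k') = - M $ 1 $ 2 * r"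
      by (simp add: det2_def Z_def field_simps)
    then show "det2 (Z ?k) (Z ?k') \<noteq> 0" using assms(1) r(2) by simp
    show "M *v Z ?k = ?k *s Z ?k" "M *v Z ?k' = ?k' *s Z ?k'"
      by (rule eig, simp add: field_simps)+
  qed
qed

lemma transversal_of_eigenvector:
  assumes "d \<noteq> 0"
    and L3: "\<And>z. d *s column_line A B 3 z = column_line A B 1 (P *v z) + column_line A B 2 (Q *v z)"
    and L4: "\<And>w. d *s column_line A B 4 w = column_line A B 1 (R *v w) + column_line A B 2 (S *v w)"
    and "det Q \<noteq> 0" and eig: "(adj2 Q ** S ** adj2 R ** P) *v z = k *s z"
  shows "singular_vectors (principal_minor_map A B) (P *v z) (Q *v z) z (adj2 R *v (P *v z))"
proof (rule singular_vectors_of_transversal [OF \<open>d \<noteq> 0\<close> L3])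
  let ?w = "adj2 R *v (P *v z)"
  \<comment> \<open>Applying \<open>Q\<close> to the eigenvector equation cancels
    \<open>adj2 Q\<close> up to \<open>det Q\<close>, so \<open>S *v ?w\<close> is a multiple of
    \<open>Q *v z\<close>.\<close>
  have "det Q *s (S *v ?w) = Q *v (adj2 Q *v (S *v ?w))" by (simp add: matrix_adj2_cancel)
  also have "\<dots> = k *s (Q *v z)"
    using eig by (simp add: matrix_vector_mul_assoc matrix_mul_assoc vector_scalar_commute)
  finally have "inverse (det Q) *s (det Q *s (S *v ?w)) = inverse (det Q) *s (k *s (Q *v z))" by simp
  then have "S *v ?w = (k / det Q) *s (Q *v z)"
    using \<open>det Q \<noteq> 0\<close> by (simp add: field_simps)
  moreover have "R *v ?w = det R *s (P *v z)" by (rule matrix_adj2_cancel)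
  ultimately show "d *s column_line A B 4 ?w =
      det R *s column_line A B 1 (P *v z) + (k / det Q) *s column_line A B 2 (Q *v z)"
    unfolding L4 by (simp add: column_line_scale)
qed

text \<open>Two independent eigenvectors give two transversals. Invertible \<open>P\<close>,
  \<open>Q\<close> and \<open>adj2 R\<close> keep their points apart on every line.\<close>

lemma principal_minor_map_in_node_tables:
  assumes d: "d \<noteq> 0"
    and L3: "\<And>z. d *s column_line A B 3 z = column_line A B 1 (P *v z) + column_line A B 2 (Q *v z)"
    and L4: "\<And>w. d *s column_line A B 4 w = column_line A B 1 (R *v w) + column_line A B 2 (S *v w)"
    and nz: "det P \<noteq> 0" "det Q \<noteq> 0" "det R \<noteq> 0"
    and M: "M = adj2 Q ** S ** adj2 R ** P" "M $ 1 $ 2 \<noteq> 0"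
      "(M $ 1 $ 1 - M $ 2 $ 2)\<^sup>2 + 4 * M $ 1 $ 2 * M $ 2 $ 1 \<noteq> 0"
  shows "principal_minor_map A B \<in> node_tables"
proof -
  obtain z z' k k' where z: "det2 z z' \<noteq> 0" "M *v z = k *s z" "M *v z' = k' *s z'"
    by (rule two_eigenvectors [OF M(2,3)])
  have "singular_vectors (principal_minor_map A B) (P *v z) (Q *v z) z (adj2 R *v (P *v z))"
    by (rule transversal_of_eigenvector [OF d L3 L4 nz(2) z(2) [unfolded M(1)]])
  moreover have "singular_vectors (principal_minor_map A B) (P *v z') (Q *v z') z' (adj2 R *v (P *v z'))"
    by (rule transversal_of_eigenvector [OF d L3 L4 nz(2) z(3) [unfolded M(1)]])
  moreover have "det2 (P *v z) (P *v z') \<noteq> 0" "det2 (Q *v z) (Q *v z') \<noteq> 0"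
    "det2 (adj2 R *v (P *v z)) (adj2 R *v (P *v z')) \<noteq> 0"
    using z(1) nz by (simp_all add: det2_matrix_vector_mult det_adj2)
  ultimately show ?thesis unfolding node_tables_def using z(1) by blast
qed

lemma det4_cramer:
  "det4 p q r s *s v = det4 v q r s *s p + det4 p v r s *s q + det4 p q v s *s r + det4 p q r v *s s"
  unfolding vec_eq_iff
proof
  fix i :: 4
  show "(det4 p q r s *s v) $ i = (det4 v q r s *s p + det4 p v r s *s q + det4 p q v s *s r + det4 p q r v *s s) $ i"
    using exhaust_4 [of i] by (elim disjE) (simp_all add: det4_expand algebra_simps)
qed

text \<open>Cramer numerators of line \<open>c\<close> along the first line: \<open>P\<close> for
  \<open>c = 3\<close> and \<open>R\<close> for \<open>c = 4\<close>. Along the second line,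
  \<open>coord_right\<close> gives \<open>Q\<close> and \<open>S\<close>.\<close>

definition coord_left :: "complex ^ 4 ^ 4 \<Rightarrow> complex ^ 4 ^ 4 \<Rightarrow> 4 \<Rightarrow> complex ^ 2 ^ 2" where
  "coord_left A B c = (\<chi> i j.
     if i = 1 then det4 (column c (if j = 1 then A else B)) (column 1 B) (column 2 A) (column 2 B)
     else det4 (column 1 A) (column c (if j = 1 then A else B)) (column 2 A) (column 2 B))"

definition coord_right :: "complex ^ 4 ^ 4 \<Rightarrow> complex ^ 4 ^ 4 \<Rightarrow> 4 \<Rightarrow> complex ^ 2 ^ 2" where
  "coord_right A B c = (\<chi> i j.
     if i = 1 then det4 (column 1 A) (column 1 B) (column c (if j = 1 then A else B)) (column 2 B)
     else det4 (column 1 A) (column 1 B) (column 2 A) (column c (if j = 1 then A else B)))"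

lemma column_line_coord:
  "det4 (column 1 A) (column 1 B) (column 2 A) (column 2 B) *s column_line A B c z =
    column_line A B 1 (coord_left A B c *v z) + column_line A B 2 (coord_right A B c *v z)"
proof -
  have "det4 (column 1 A) (column 1 B) (column 2 A) (column 2 B) *s column_line A B c z =
     z $ 1 *s (det4 (column 1 A) (column 1 B) (column 2 A) (column 2 B) *s column c A) +
     z $ 2 *s (det4 (column 1 A) (column 1 B) (column 2 A) (column 2 B) *s column c B)"
    by (simp add: column_line_def vec_eq_iff algebra_simps)
  then show ?thesis
    unfolding det4_cramer [of _ _ _ _ "column c A"] det4_cramer [of _ _ _ _ "column c B"]
    by (simp add: column_line_def coord_left_def coord_right_def matrix_vector_mult_def sum_2
      vec_eq_iff algebra_simps)
qed

text \<open>If \<open>P, Q\<close> and \<open>R, S\<close> express the third and fourth line in terms of the first two, a transversal meets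
  the third line at \<open>z\<close> and the fourth at \<open>w\<close> where \<open>R w\<close> is a multiple of \<open>P z\<close> and \<open>S w\<close> one of \<open>Q z\<close>.
  Eliminating \<open>w\<close> makes \<open>z\<close> an eigenvector of \<open>Q\<^sup>-\<^sup>1 S R\<^sup>-\<^sup>1 P\<close>; adjugates keep the entries polynomial.\<close>

definition pencil_matrix :: "complex ^ 4 ^ 4 \<Rightarrow> complex ^ 4 ^ 4 \<Rightarrow> complex ^ 2 ^ 2" where
  "pencil_matrix A B =
     adj2 (coord_right A B 3) ** coord_right A B 4 ** adj2 (coord_left A B 4) ** coord_left A B 3"

text \<open>All nondegeneracy conditions multiplied into a single polynomial, the last factor being
  the discriminant.\<close>

definition genericity :: "complex ^ 4 ^ 4 \<Rightarrow> complex ^ 4 ^ 4 \<Rightarrow> complex" where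
  "genericity A B = det4 (column 1 A) (column 1 B) (column 2 A) (column 2 B) *
     det (coord_left A B 3) * det (coord_right A B 3) * det (coord_left A B 4) *
     pencil_matrix A B $ 1 $ 2 *
     ((pencil_matrix A B $ 1 $ 1 - pencil_matrix A B $ 2 $ 2)\<^sup>2 +
       4 * pencil_matrix A B $ 1 $ 2 * pencil_matrix A B $ 2 $ 1)"

lemma generic_in_node_tables:
  assumes "genericity A B \<noteq> 0"
  shows "principal_minor_map A B \<in> node_tables"
  by (rule principal_minor_map_in_node_tables [OF _ column_line_coord column_line_coord, OF _ _ _ _ pencil_matrix_def])
    (use assms in \<open>simp_all add: genericity_def\<close>)

text \<open>The witness has \<open>P = Q = R = 1\<close> and \<open>S\<close> the coordinate swap.\<close>

lemma ex_genericity: "\<exists>A B. genericity A B \<noteq> 0"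
proof -
  \<comment> \<open>In the unit vectors \<open>e1\<close> to \<open>e4\<close>, the four lines are
    spanned by \<open>e1, e2\<close>; \<open>e3, e4\<close>; \<open>e1 + e3, e2 + e4\<close>; and
    \<open>e1 + e4, e2 + e3\<close>.\<close>
  define A :: "complex ^ 4 ^ 4"
    where "A = (\<chi> i j. if (i, j) \<in> {(1, 1), (3, 2), (1, 3), (3, 3), (1, 4), (4, 4)} then 1 else 0)"
  define B :: "complex ^ 4 ^ 4"
    where "B = (\<chi> i j. if (i, j) \<in> {(2, 1), (4, 2), (2, 3), (4, 3), (2, 4), (3, 4)} then 1 else 0)"
  have 1: "det4 (column 1 A) (column 1 B) (column 2 A) (column 2 B) = 1"
    by (simp add: det4_expand column_def A_def B_def)
  have 2: "coord_left A B 3 = mat 1" "coord_right A B 3 = mat 1" "coord_left A B 4 = mat 1"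
    by (simp_all add: vec_eq_iff forall_2 mat_def coord_left_def coord_right_def det4_expand
        column_def A_def B_def)
  have 3: "coord_right A B 4 $ i $ j = (if i = j then 0 else 1)" for i j
    using exhaust_2 [of i] exhaust_2 [of j]
    by (auto simp: coord_right_def det4_expand column_def A_def B_def)
  have "adj2 (mat 1) = (mat 1 :: complex ^ 2 ^ 2)"
    by (simp add: vec_eq_iff forall_2 adj2_nth mat_def)
  then have "genericity A B \<noteq> 0"
    unfolding genericity_def pencil_matrix_def 1 2 by (simp add: 3)
  then show ?thesis by blast
qed

section \<open>Polynomial functions of one variable and density of generic matrices\<close>

definition polyfun :: "('a::comm_ring_1 \<Rightarrow> 'a) \<Rightarrow> bool" where
  "polyfun f \<longleftrightarrow> (\<exists>p. f = poly p)"

lemma polyfun_const: "polyfun (\<lambda>t. c)"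
  unfolding polyfun_def by (rule exI [of _ "[:c:]"]) auto

lemma polyfun_id: "polyfun (\<lambda>t. t)"
  unfolding polyfun_def by (rule exI [of _ "[:0, 1:]"]) auto

lemma polyfun_add: "polyfun f \<Longrightarrow> polyfun g \<Longrightarrow> polyfun (\<lambda>t. f t + g t)"
  unfolding polyfun_def fun_eq_iff by (metis poly_add)

lemma polyfun_uminus: "polyfun f \<Longrightarrow> polyfun (\<lambda>t. - f t)"
  unfolding polyfun_def fun_eq_iff by (metis poly_minus)

lemma polyfun_diff: "polyfun f \<Longrightarrow> polyfun g \<Longrightarrow> polyfun (\<lambda>t. f t - g t)"
  unfolding polyfun_def fun_eq_iff by (metis poly_diff)

lemma polyfun_mult: "polyfun f \<Longrightarrow> polyfun g \<Longrightarrow> polyfun (\<lambda>t. f t * g t)"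
  unfolding polyfun_def fun_eq_iff by (metis poly_mult)

lemmas polyfun_intros = polyfun_const polyfun_id polyfun_add polyfun_uminus polyfun_diff polyfun_mult

lemma polyfun_det4:
  assumes "\<And>i. polyfun (\<lambda>t. p t $ i)" "\<And>i. polyfun (\<lambda>t. q t $ i)"
    "\<And>i. polyfun (\<lambda>t. r t $ i)" "\<And>i. polyfun (\<lambda>t. s t $ i)"
  shows "polyfun (\<lambda>t. det4 (p t) (q t) (r t) (s t))"
  by (simp add: det4_expand polyfun_intros assms)

lemma polyfun_det_2:
  fixes X :: "_ \<Rightarrow> _ ^ 2 ^ 2"
  assumes "\<And>i j. polyfun (\<lambda>t. X t $ i $ j)"
  shows "polyfun (\<lambda>t. det (X t))"
  unfolding det_2 by (intro polyfun_intros assms)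

lemma polyfun_adj2:
  assumes "\<And>i j. polyfun (\<lambda>t. X t $ i $ j)"
  shows "polyfun (\<lambda>t. adj2 (X t) $ i $ j)"
  unfolding adj2_def by (cases "i = j"; cases "i = 1"; simp add: polyfun_uminus assms)

lemma polyfun_matrix_mult:
  fixes X Y :: "_ \<Rightarrow> _ ^ 2 ^ 2"
  assumes "\<And>i j. polyfun (\<lambda>t. X t $ i $ j)" "\<And>i j. polyfun (\<lambda>t. Y t $ i $ j)"
  shows "polyfun (\<lambda>t. (X t ** Y t) $ i $ j)"
  unfolding matrix_matrix_mult_def by (simp add: sum_2) (intro polyfun_intros assms)

lemma finite_zeros_polyfun:
  fixes f :: "'a::idom \<Rightarrow> 'a"
  assumes "polyfun f" "f t \<noteq> 0"
  shows "finite {t. f t = 0}"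
proof -
  obtain p where p: "f = poly p" using assms(1) unfolding polyfun_def by blast
  with assms(2) have "p \<noteq> 0" by auto
  then show ?thesis unfolding p by (rule poly_roots_finite)
qed

lemma continuous_on_polyfun:
  fixes f :: "complex \<Rightarrow> complex"
  assumes "polyfun f"
  shows "continuous_on S f"
  using assms unfolding polyfun_def by (auto intro!: continuous_intros)

text \<open>On the line from \<open>(A, B)\<close> at \<open>t = 0\<close> to a generic pair at
  \<open>t = 1\<close>, \<open>genericity\<close> is a nonzero polynomial in \<open>t\<close>. Its
  zeros are finite in number, so \<open>t = 0\<close> is a limit of generic parameters.\<close>

lemma principal_minor_tables_subset: "principal_minor_tables \<subseteq> closure node_tables"
proof
  fix a assume "a \<in> principal_minor_tables"
  then obtain A B where a: "a = principal_minor_map A B"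
    unfolding principal_minor_tables_def by blast
  obtain A\<^sub>0 B\<^sub>0 where gen: "genericity A\<^sub>0 B\<^sub>0 \<noteq> 0"
    using ex_genericity by blast
  define X where "X = (\<lambda>t. \<chi> i j. A $ i $ j + t * (A\<^sub>0 $ i $ j - A $ i $ j))"
  define Y where "Y = (\<lambda>t. \<chi> i j. B $ i $ j + t * (B\<^sub>0 $ i $ j - B $ i $ j))"
  have col: "polyfun (\<lambda>t. column c (X t) $ i)" "polyfun (\<lambda>t. column c (Y t) $ i)" for c i
    by (simp_all add: column_def X_def Y_def, (intro polyfun_intros)+)
  have coord: "polyfun (\<lambda>t. coord_left (X t) (Y t) c $ i $ j)"
    "polyfun (\<lambda>t. coord_right (X t) (Y t) c $ i $ j)" for c i j
    unfolding coord_left_def coord_right_def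
    by (cases "i = 1"; cases "j = 1"; simp; intro polyfun_det4 col)+
  have pencil: "polyfun (\<lambda>t. pencil_matrix (X t) (Y t) $ i $ j)" for i j
    unfolding pencil_matrix_def by (intro polyfun_matrix_mult polyfun_adj2 coord)
  have "polyfun (\<lambda>t. genericity (X t) (Y t))"
    unfolding genericity_def power2_eq_square
    by (intro polyfun_mult polyfun_add polyfun_diff polyfun_const polyfun_det4 polyfun_det_2 col coord pencil)
  moreover have "X 1 = A\<^sub>0" "Y 1 = B\<^sub>0" "X 0 = A" "Y 0 = B"
    by (simp_all add: X_def Y_def vec_eq_iff)
  ultimately have fin: "finite {t. genericity (X t) (Y t) = 0}"
    using gen finite_zeros_polyfun [of "\<lambda>t. genericity (X t) (Y t)" 1] by simp
  have "closure {t. genericity (X t) (Y t) \<noteq> 0} = UNIV"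
    using empty_interior_finite [OF fin] closure_complement [of "{t. genericity (X t) (Y t) = 0}"]
    by (simp add: Collect_neg_eq)
  moreover have "continuous_on S (\<lambda>t. principal_minor_map (X t) (Y t))" for S
  proof -
    have "polyfun (\<lambda>t. principal_minor_map (X t) (Y t) $ (i, j, k, l))" for i j k l
      unfolding principal_minor_map_nth
      by (cases "i = 1"; cases "j = 1"; cases "k = 1"; cases "l = 1"; simp; intro polyfun_det4 col)
    then have "continuous_on S (\<lambda>t. principal_minor_map (X t) (Y t) $ m)" for m
      by (cases m) (simp add: continuous_on_polyfun)
    then have "continuous_on S (\<lambda>t. \<chi> m. principal_minor_map (X t) (Y t) $ m)"
      by (rule continuous_on_vec_lambda)
    then show ?thesis by simp
  qed
  moreover have "(\<lambda>t. principal_minor_map (X t) (Y t)) ` {t. genericity (X t) (Y t) \<noteq> 0} \<subseteq> closure node_tables"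
    using generic_in_node_tables closure_subset by blast
  ultimately have "(\<lambda>t. principal_minor_map (X t) (Y t)) ` UNIV \<subseteq> closure node_tables"
    using image_closure_subset [OF _ closed_closure,
        of "{t. genericity (X t) (Y t) \<noteq> 0}" "\<lambda>t. principal_minor_map (X t) (Y t)" node_tables]
    by simp
  then have "principal_minor_map (X 0) (Y 0) \<in> closure node_tables" by blast
  then show "a \<in> closure node_tables"
    unfolding a \<open>X 0 = A\<close> \<open>Y 0 = B\<close> .
qed

theorem theorem13:
  shows "V4 = node_component"
  unfolding V4_eq node_component_eq
  by (intro equalityI zariski_closure_mono_closure principal_minor_tables_subset node_tables_subset)

end
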